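(* Let $E,F$ be Banach spaces, $U\subset E$ open, $g:U\to F$ a $C^1$ map, $f:U\to\mathbb{R}$ a $C^1$ (not necessarily linear) functional, $y_0\in F$, and $S=g^{-1}(y_0)$. If $y_0$ is a generalized regular value of $g$ and $x\in U$ is a critical point of $f|_S$, then for every generalized inverse $g'^{+}(x)\in GI(g'(x))$ of $g'(x)$, $$f'(x)-f'(x)\circ g'^{+}(x)\circ g'(x)=0\quad\text{and}\quad g(x)=y_0;$$ that is, $f'(x)\circ g'^{+}(x)\in F^*$ is a Lagrange multiplier.
   Context: $N(\cdot)$ and $R(\cdot)$ denote null space and range of an operator; $g'(x),f'(x)$ are Fréchet derivatives; $B(E,F)$ is the space of bounded linear operators. $A\in B(E,F)$ is double split if $R(A)$ is closed and there are closed subspaces $R_+\subset E$, $N_+\subset F$ with $E=N(A)\oplus R_+$ and $F=R(A)\oplus N_+$. A generalized inverse of a double split $A$ is an $A^+\in B(F,E)$ with $AA^+A=A$ and $A^+AA^+=A^+$; $GI(A)$ is the set of all of them. A point $x_0\in U$ is a generalized regular point of $g$ if $g'(x_0)$ is double split, $F=R(g'(x_0))\oplus N_+$ with $N_+$ a closed subspace, and there is a neighborhood $U_0\subset U$ of $x_0$ such that $R(g'(x))\cap N_+=\{0\}$ for all $x\in U_0$. The element $y_0\in F$ is a generalized regular value of $g$ if $g^{-1}(y_0)$ is empty or consists only of generalized regular points; in that case $S$ is a $C^1$ submanifold of $U$ with $T_xS=N(g'(x))$ for $x\in S$ (known result). A point $x$ is a critical point of $f|_S$ if $x\in S$ and,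 for every $C^1$ curve $c:(-\varepsilon,\varepsilon)\to U$ with values in $S$ and $c(0)=x$, one has $\frac{d}{dt}f(c(t))|_{t=0}=0$. A Lagrange multiplier at $x\in S$ is an $L\in F^*$ satisfying the Euler equations $f'(x)-L\circ g'(x)=0$, $g(x)=y_0$. *)

theory Defs
  imports "HOL-Analysis.Analysis"
begin

text \<open>
  Bounded operators are elements of \<^typ>\<open>'a \<Rightarrow>\<^sub>L 'b\<close>.  A map defined on an open set \<open>U\<close> is
  represented by a total function of which only the values on \<open>U\<close> are used.  Its Frechet
  derivative is carried as an explicit operator-valued function; on the open set \<open>U\<close> it is
  uniquely determined by the map.
\<close>

definition C1_map_on ::
    "'a::real_normed_vector set \<Rightarrow> ('a \<Rightarrow> 'b::real_normed_vector) \<Rightarrow> ('a \<Rightarrow> 'a \<Rightarrow>\<^sub>L 'b) \<Rightarrow> bool" where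
  "C1_map_on U g g' \<longleftrightarrow>
     (\<forall>x\<in>U. (g has_derivative blinfun_apply (g' x)) (at x)) \<and> continuous_on U g'"

definition null_space :: "('a::real_normed_vector \<Rightarrow>\<^sub>L 'b::real_normed_vector) \<Rightarrow> 'a set" where
  "null_space A = {x. blinfun_apply A x = 0}"

definition range_space :: "('a::real_normed_vector \<Rightarrow>\<^sub>L 'b::real_normed_vector) \<Rightarrow> 'b set" where
  "range_space A = range (blinfun_apply A)"

definition is_direct_sum :: "'a::real_vector set \<Rightarrow> 'a set \<Rightarrow> bool" where
  "is_direct_sum M N \<longleftrightarrow> {m + n | m n. m \<in> M \<and> n \<in> N} = UNIV \<and> M \<inter> N = {0}"

definition closed_complement :: "'a::real_normed_vector set \<Rightarrow> 'a set \<Rightarrow> bool" where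
  "closed_complement M N \<longleftrightarrow> subspace N \<and> closed N \<and> is_direct_sum M N"

definition double_split :: "('a::real_normed_vector \<Rightarrow>\<^sub>L 'b::real_normed_vector) \<Rightarrow> bool" where
  "double_split A \<longleftrightarrow> closed (range_space A)
     \<and> (\<exists>R\<^sub>p. closed_complement (null_space A) R\<^sub>p)
     \<and> (\<exists>N\<^sub>p. closed_complement (range_space A) N\<^sub>p)"

definition GI :: "('a::real_normed_vector \<Rightarrow>\<^sub>L 'b::real_normed_vector) \<Rightarrow> ('b \<Rightarrow>\<^sub>L 'a) set" where
  "GI A = {B. A o\<^sub>L B o\<^sub>L A = A \<and> B o\<^sub>L A o\<^sub>L B = B}"

text \<open>The only property of the map itself that enters here is its derivative.\<close>

definition generalized_regular_point ::
    "'a::real_normed_vector set \<Rightarrow> ('a \<Rightarrow> 'a \<Rightarrow>\<^sub>L 'b::real_normed_vector) \<Rightarrow> 'a \<Rightarrow> bool" where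
  "generalized_regular_point U g' x\<^sub>0 \<longleftrightarrow> x\<^sub>0 \<in> U \<and> double_split (g' x\<^sub>0)
     \<and> (\<exists>N\<^sub>p. closed_complement (range_space (g' x\<^sub>0)) N\<^sub>p
          \<and> (\<exists>U\<^sub>0. open U\<^sub>0 \<and> x\<^sub>0 \<in> U\<^sub>0 \<and> U\<^sub>0 \<subseteq> U
                \<and> (\<forall>x\<in>U\<^sub>0. range_space (g' x) \<inter> N\<^sub>p = {0})))"

definition level_set :: "'a set \<Rightarrow> ('a \<Rightarrow> 'b) \<Rightarrow> 'b \<Rightarrow> 'a set" where
  "level_set U g y\<^sub>0 = {x \<in> U. g x = y\<^sub>0}"

definition generalized_regular_value ::
    "'a::real_normed_vector set \<Rightarrow> ('a \<Rightarrow> 'b) \<Rightarrow> ('a \<Rightarrow> 'a \<Rightarrow>\<^sub>L 'b::real_normed_vector) \<Rightarrow> 'b \<Rightarrow> bool" where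
  "generalized_regular_value U g g' y\<^sub>0 \<longleftrightarrow>
     (\<forall>x \<in> level_set U g y\<^sub>0. generalized_regular_point U g' x)"

definition critical_point_on :: "'a::real_normed_vector set \<Rightarrow> ('a \<Rightarrow> real) \<Rightarrow> 'a \<Rightarrow> bool" where
  "critical_point_on S f x \<longleftrightarrow> x \<in> S
     \<and> (\<forall>\<epsilon>>0. \<forall>c. c C1_differentiable_on {-\<epsilon><..<\<epsilon>} \<and> c ` {-\<epsilon><..<\<epsilon>} \<subseteq> S \<and> c 0 = x
           \<longrightarrow> ((\<lambda>t. f (c t)) has_real_derivative 0) (at 0))"

definition lagrange_multiplier ::
    "'a::real_normed_vector set \<Rightarrow> ('a \<Rightarrow> 'b) \<Rightarrow> ('a \<Rightarrow> 'a \<Rightarrow>\<^sub>L 'b::real_normed_vector)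
      \<Rightarrow> ('a \<Rightarrow> 'a \<Rightarrow>\<^sub>L real) \<Rightarrow> 'b \<Rightarrow> 'a \<Rightarrow> ('b \<Rightarrow>\<^sub>L real) \<Rightarrow> bool" where
  "lagrange_multiplier U g g' f' y\<^sub>0 x L \<longleftrightarrow>
     x \<in> level_set U g y\<^sub>0 \<and> f' x - (L o\<^sub>L g' x) = 0 \<and> g x = y\<^sub>0"

end

theory Submission
  imports Defs
begin

text \<open>
  It suffices to realise every \<open>h \<in> N(g'(x))\<close> as the velocity at \<open>x\<close> of a \<open>C\<^sup>1\<close> curve in \<open>S\<close>:
  then \<open>f'(x)\<close> vanishes on \<open>N(g'(x))\<close>, which contains \<open>v - G (g'(x) v)\<close> for every \<open>v\<close>.

  Let \<open>A = g'(x)\<close>, let \<open>P\<close> be the projection onto \<open>R(A)\<close> along the complement \<open>N\<^sub>+\<close> of the regularity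
  condition (continuous by the closed graph theorem), and put \<open>T = G P\<close>, so that \<open>A T = P\<close>. The map
  \<open>\<Phi>(z) = z + T (g(z) - A z)\<close> has derivative \<open>id\<close> at \<open>x\<close>, so it lifts the line
  \<open>\<Phi>(x) + t h\<close> to a \<open>C\<^sup>1\<close> curve \<open>c\<close>. Differentiating \<open>\<Phi>(c(t))\<close> and applying \<open>A\<close>
  gives \<open>P (g'(c) c') = A h = 0\<close>, that is \<open>g'(c) c' \<in> R(g'(c)) \<inter> N\<^sub>+ = {0}\<close>; hence \<open>g \<circ> c\<close> is
  constant.
\<close>

section \<open>Closed graphs and bounded projections\<close>

text \<open>By Baire, some set on which \<open>P\<close> is bounded is dense in a ball. Linearity
  turns this into approximation of any vector, at half its norm as error, by one with controlled
  image. Correcting the error repeatedly writes the vector as a series whose images converge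
  absolutely; the graph condition identifies their sum.\<close>

lemma closed_graph_imp_bounded_linear:
  fixes P :: "'a::banach \<Rightarrow> 'b::banach"
  assumes lin: "linear P"
    and graph: "\<And>X x y. X \<longlonglongrightarrow> x \<Longrightarrow> (\<lambda>n. P (X n)) \<longlonglongrightarrow> y \<Longrightarrow> P x = y"
  shows "bounded_linear P"
proof -
  interpret linear P by fact
  define V where "V n = {y. norm (P y) \<le> real n}" for n :: nat
  have "\<exists>n. interior (closure (V n)) \<noteq> {}"
  proof (rule ccontr)
    assume "\<not> ?thesis"
    then have "euclidean interior_of \<Union>(range (\<lambda>n. closure (V n))) = {}"
      by (intro Baire_category_alt) (auto simp: completely_metrizable_space_euclidean)
    moreover have "y \<in> \<Union>(range (\<lambda>n. closure (V n)))" for y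
    proof -
      obtain n :: nat where "norm (P y) \<le> real n"
        using real_arch_simple by blast
      then show ?thesis
        using closure_subset[of "V n"] by (auto simp: V_def)
    qed
    then have "\<Union>(range (\<lambda>n. closure (V n))) = UNIV" by blast
    ultimately show False by simp
  qed
  then obtain n a where "a \<in> interior (closure (V n))" by blast
  then obtain r where r: "r > 0" "ball a r \<subseteq> closure (V n)"
    by (meson mem_interior)
  define K where "K = 4 * real n / r"
  have approx: "\<exists>z. norm (y - z) \<le> norm y / 2 \<and> norm (P z) \<le> K * norm y" for y
  proof (cases "y = 0")
    case True
    then show ?thesis by (intro exI[of _ 0]) (simp add: zero)
  next
    case False
    \<comment> \<open>The scaling puts both \<open>a\<close> and \<open>a + s *\<^sub>R y\<close> in
      the ball. Approximating each within \<open>r / 8\<close> approximates their difference, of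
      norm \<open>r / 2\<close>, within \<open>r / 4\<close>, a relative error of one half. Dividing
      \<open>2 * real n\<close> by \<open>s\<close> gives the constant \<open>K\<close>.\<close>
    define s where "s = r / (2 * norm y)"
    have s: "s > 0" using False r by (simp add: s_def)
    have "norm (s *\<^sub>R y) = r / 2" using False r by (simp add: s_def)
    then have "a + s *\<^sub>R y \<in> ball a r" "a \<in> ball a r" using r by (auto simp: dist_norm)
    then have cl: "a + s *\<^sub>R y \<in> closure (V n)" "a \<in> closure (V n)" using r by blast+
    have e: "r / 8 > 0" using r by simp
    obtain u where u: "u \<in> V n" "dist u (a + s *\<^sub>R y) < r / 8"
      using cl(1) e unfolding closure_approachable by blast
    obtain w where w: "w \<in> V n" "dist w a < r / 8"
      using cl(2) e unfolding closure_approachable by blast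
    have "norm (s *\<^sub>R y - (u - w)) = norm ((w - a) - (u - (a + s *\<^sub>R y)))"
      by (simp add: algebra_simps)
    also have "\<dots> \<le> r / 4"
      using u(2) w(2) norm_triangle_ineq4[of "w - a" "u - (a + s *\<^sub>R y)"] by (simp add: dist_norm)
    finally have 1: "norm (s *\<^sub>R y - (u - w)) \<le> r / 4" .
    have 2: "norm (P (u - w)) \<le> 2 * real n"
      using u(1) w(1) norm_triangle_ineq4[of "P u" "P w"] by (simp add: V_def diff)
    define z where "z = (1 / s) *\<^sub>R (u - w)"
    have "y - z = (1 / s) *\<^sub>R (s *\<^sub>R y - (u - w))"
      using s by (simp add: z_def scaleR_diff_right)
    then have "norm (y - z) = norm (s *\<^sub>R y - (u - w)) / s"
      using s by (simp only: norm_scaleR) simp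
    also have "\<dots> \<le> (r / 4) / s"
      using 1 s by (intro divide_right_mono) auto
    also have "\<dots> = norm y / 2" using False r by (simp add: s_def)
    finally have 3: "norm (y - z) \<le> norm y / 2" .
    have "norm (P z) = norm (P (u - w)) / s"
      using s by (simp add: z_def scale)
    also have "\<dots> \<le> 2 * real n / s"
      using 2 s by (intro divide_right_mono) auto
    also have "\<dots> = K * norm y" using False r by (simp add: s_def K_def)
    finally show ?thesis using 3 by blast
  qed
  then obtain Z where Z: "\<And>y. norm (y - Z y) \<le> norm y / 2" "\<And>y. norm (P (Z y)) \<le> K * norm y"
    by metis
  have K: "K \<ge> 0" using r by (simp add: K_def)
  show ?thesis
  proof (intro bounded_linear_intro[where K = "2 * K"] add scale)
    fix y
    \<comment> \<open>\<open>w k\<close> is the error left after k corrections, so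
      \<open>y - w k\<close> is the sum of the first k of them.\<close>
    define w where "w k = ((\<lambda>u. u - Z u) ^^ k) y" for k
    have w0: "w 0 = y" and wS: "w (Suc k) = w k - Z (w k)" for k
      by (simp_all add: w_def)
    have w_le: "norm (w k) \<le> norm y * (1/2) ^ k" for k
    proof (induction k)
      case (Suc k)
      then show ?case using Z(1)[of "w k"] by (simp add: wS)
    qed (simp add: w0)
    have "(\<lambda>k. norm y * (1/2) ^ k) \<longlonglongrightarrow> norm y * 0"
      by (intro tendsto_intros) auto
    then have w_lim: "w \<longlonglongrightarrow> 0"
      using w_le by (intro Lim_null_comparison[where f = w]) auto
    have PZ: "norm (P (Z (w k))) \<le> K * norm y * (1/2) ^ k" for k
      using order_trans[OF Z(2)[of "w k"] mult_left_mono[OF w_le[of k] K]] by (simp add: mult.assoc)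
    have geo: "(\<lambda>k. K * norm y * (1/2) ^ k) sums (K * norm y * 2)"
      using sums_mult[OF geometric_sums[of "1/2::real"]] by simp
    have summ: "summable (\<lambda>k. norm (P (Z (w k))))"
      by (rule summable_comparison_test'[OF sums_summable[OF geo]]) (use PZ in simp)
    have "(\<lambda>k. y - w k) \<longlonglongrightarrow> y"
      using tendsto_diff[OF tendsto_const w_lim] by simp
    moreover have "P (y - w k) = (\<Sum>j<k. P (Z (w j)))" for k
    proof (induction k)
      case (Suc k)
      have "y - w (Suc k) = (y - w k) + Z (w k)" by (simp add: wS)
      then show ?case by (simp only: add Suc sum.lessThan_Suc)
    qed (simp add: w0 zero)
    then have "(\<lambda>k. P (y - w k)) \<longlonglongrightarrow> (\<Sum>j. P (Z (w j)))"
      using summable_LIMSEQ[OF summable_norm_cancel[OF summ]] by simp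
    \<comment> \<open>The points \<open>y - w k\<close> tend to \<open>y\<close> and their images to
      the series, which is exactly the situation of the graph condition.\<close>
    ultimately have "P y = (\<Sum>j. P (Z (w j)))"
      by (rule graph)
    also have "norm \<dots> \<le> (\<Sum>k. norm (P (Z (w k))))"
      by (rule summable_norm[OF summ])
    also have "\<dots> \<le> (\<Sum>k. K * norm y * (1/2) ^ k)"
      by (rule suminf_le[OF PZ summ sums_summable[OF geo]])
    finally show "norm (P y) \<le> norm y * (2 * K)"
      using sums_unique[OF geo] by (simp add: mult_ac)
  qed
qed

text \<open>Both summands are closed, so a limit of decompositions is again a decomposition; by
  uniqueness the algebraic projection has closed graph.\<close>

lemma bounded_projection_exists:
  fixes M N :: "'a::banach set"
  assumes M: "subspace M" "closed M" and MN: "closed_complement M N"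
  obtains P :: "'a \<Rightarrow>\<^sub>L 'a"
  where "\<And>m. m \<in> M \<Longrightarrow> P m = m" "\<And>y. P y \<in> M" "\<And>y. y - P y \<in> N"
proof -
  have N: "subspace N" "closed N" and sum: "\<And>y. \<exists>m\<in>M. \<exists>n\<in>N. y = m + n" and int: "M \<inter> N = {0}"
    using MN unfolding closed_complement_def is_direct_sum_def by blast+
  obtain p where p: "\<And>y. p y \<in> M" "\<And>y. y - p y \<in> N"
    using sum by (metis add_diff_cancel_left')
  \<comment> \<open>Linearity, the graph condition and the identity on \<open>M\<close> are all read
    off from this uniqueness.\<close>
  have uniq: "p y = m" if "m \<in> M" "y - m \<in> N" for y m
  proof -
    have "p y - m \<in> M" using subspace_diff[OF M(1) p(1) that(1)] .
    moreover have "p y - m \<in> N"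
      using subspace_diff[OF N(1) that(2) p(2)[of y]] by simp
    ultimately have "p y - m \<in> {0}" using int by blast
    then show ?thesis by simp
  qed
  have "linear p"
  proof
    fix y z :: 'a and r :: real
    have "(y + z) - (p y + p z) \<in> N"
      using subspace_add[OF N(1) p(2)[of y] p(2)[of z]] by (simp add: algebra_simps)
    then show "p (y + z) = p y + p z"
      by (intro uniq subspace_add M p)
    have "r *\<^sub>R y - r *\<^sub>R p y \<in> N"
      using subspace_scale[OF N(1) p(2)[of y]] by (simp add: scaleR_diff_right)
    then show "p (r *\<^sub>R y) = r *\<^sub>R p y"
      by (intro uniq subspace_scale M p)
  qed
  then have "bounded_linear p"
  proof (rule closed_graph_imp_bounded_linear)
    fix X x y assume X: "X \<longlonglongrightarrow> x" and pX: "(\<lambda>n. p (X n)) \<longlonglongrightarrow> y"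
    show "p x = y"
    proof (rule uniq)
      show "y \<in> M" using closed_sequentially[OF M(2) p(1) pX] .
      show "x - y \<in> N" using closed_sequentially[OF N(2) p(2) tendsto_diff[OF X pX]] .
    qed
  qed
  then have "blinfun_apply (Blinfun p) = p"
    by (rule bounded_linear_Blinfun_apply)
  moreover have "p m = m" if "m \<in> M" for m
    using that subspace_0[OF N(1)] by (intro uniq) auto
  ultimately show thesis
    using p by (intro that[of "Blinfun p"]) auto
qed

section \<open>Lifting a line through a map whose derivative is close to the identity\<close>

lemma norm_le_near_id_blinfun:
  fixes B :: "'a::real_normed_vector \<Rightarrow>\<^sub>L 'a"
  assumes "norm (id_blinfun - B) \<le> 1/2"
  shows "norm v \<le> 2 * norm (B v)"
proof -
  have "norm (v - B v) \<le> 1/2 * norm v"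
    using order_trans[OF norm_blinfun[of "id_blinfun - B" v] mult_right_mono[OF assms norm_ge_zero]]
    by (simp add: blinfun.diff_left)
  then show ?thesis
    using norm_triangle_sub[of v "B v"] by simp
qed

text \<open>A solution is a fixed point of the 1/2-contraction sending v to
  \<open>v - B v + h\<close>.\<close>

lemma near_id_blinfun_surj:
  fixes B :: "'a::banach \<Rightarrow>\<^sub>L 'a"
  assumes "norm (id_blinfun - B) \<le> 1/2"
  shows "\<exists>v. B v = h"
proof -
  have "dist (v - B v + h) (w - B w + h) \<le> 1/2 * dist v w" for v w
  proof -
    have "(v - B v + h) - (w - B w + h) = (id_blinfun - B) (v - w)"
      by (simp add: blinfun.diff_left blinfun.diff_right)
    then show ?thesis
      using order_trans[OF norm_blinfun[of "id_blinfun - B" "v - w"]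
          mult_right_mono[OF assms norm_ge_zero]]
      by (simp add: dist_norm)
  qed
  then have "\<exists>!v. v - B v + h = v"
    by (intro banach_fix_type[of "1/2"]) auto
  then obtain v where "v - B v + h = v" by blast
  then have "B v = h" by (simp add: algebra_simps)
  then show ?thesis ..
qed

text \<open>This is the inverse function theorem along one line. Near \<open>x\<close> the map z -
  \<Phi>(z) is a 1/2-contraction, so \<Phi>(z) = \<Phi>(x) + t h is solvable with Lipschitz
  dependence on t. The velocity is the preimage of \<open>h\<close> under the derivative of \<Phi>
  at the solution.\<close>

lemma C1_line_lift:
  fixes \<Phi> :: "'a::banach \<Rightarrow> 'a"
  assumes "open U" "x \<in> U" and C1: "C1_map_on U \<Phi> \<Phi>'" and id: "\<Phi>' x = id_blinfun"
  obtains \<epsilon> :: real and c D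
  where "\<epsilon> > 0" "c 0 = x" "D 0 = h"
    "\<And>t. t \<in> {-\<epsilon><..<\<epsilon>} \<Longrightarrow> c t \<in> U"
    "\<And>t. t \<in> {-\<epsilon><..<\<epsilon>} \<Longrightarrow> (c has_vector_derivative D t) (at t)"
    "\<And>t. t \<in> {-\<epsilon><..<\<epsilon>} \<Longrightarrow> \<Phi>' (c t) (D t) = h"
    "continuous_on {-\<epsilon><..<\<epsilon>} D"
proof -
  have der: "\<And>z. z \<in> U \<Longrightarrow> (\<Phi> has_derivative \<Phi>' z) (at z)" and cont: "continuous_on U \<Phi>'"
    using C1 by (auto simp: C1_map_on_def)
  have "isCont \<Phi>' x"
    using cont assms(1,2) by (simp add: continuous_on_eq_continuous_at)
  then obtain d1 where d1: "d1 > 0" "\<And>z. dist z x < d1 \<Longrightarrow> dist (\<Phi>' z) (\<Phi>' x) < 1/2"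
    unfolding continuous_at_eps_delta by (meson half_gt_zero zero_less_one)
  obtain d2 where d2: "d2 > 0" "cball x d2 \<subseteq> U"
    using assms(1,2) open_contains_cball by metis
  \<comment> \<open>Halving \<open>d1\<close> lets the closed ball, needed for completeness, fit
    inside the open ball of radius \<open>d1\<close>.\<close>
  define \<delta> where "\<delta> = min (d1 / 2) d2"
  have \<delta>: "\<delta> > 0" using d1 d2 by (simp add: \<delta>_def)
  define C where "C = cball x \<delta>"
  have CU: "z \<in> U" if "z \<in> C" for z
    using that d2(2) by (auto simp: C_def \<delta>_def)
  have near: "norm (id_blinfun - \<Phi>' z) \<le> 1/2" if "z \<in> C" for z
    using d1(2)[of z] that d1(1) by (simp add: C_def \<delta>_def id dist_commute dist_norm)
  define \<psi> where "\<psi> z = z - \<Phi> z" for z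
  have lip: "norm (\<psi> z - \<psi> w) \<le> 1/2 * norm (z - w)" if "z \<in> C" "w \<in> C" for z w
  proof (rule differentiable_bound[OF _ _ _ that])
    show "convex C" by (simp add: C_def)
    fix y assume y: "y \<in> C"
    have "((\<lambda>z. z - \<Phi> z) has_derivative (\<lambda>v. v - \<Phi>' y v)) (at y)"
      by (intro derivative_intros der CU y)
    moreover have "blinfun_apply (id_blinfun - \<Phi>' y) = (\<lambda>v. v - \<Phi>' y v)"
      by (auto simp: blinfun.diff_left)
    ultimately show "(\<psi> has_derivative blinfun_apply (id_blinfun - \<Phi>' y)) (at y within C)"
      by (simp add: \<psi>_def[abs_def] has_derivative_at_withinI)
    show "onorm (blinfun_apply (id_blinfun - \<Phi>' y)) \<le> 1/2"
      using near[OF y] by (simp add: norm_blinfun.rep_eq)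
  qed
  have inj: "norm (z - w) \<le> 2 * norm (\<Phi> z - \<Phi> w)" if "z \<in> C" "w \<in> C" for z w
  proof -
    have "z - w = (\<psi> z - \<psi> w) + (\<Phi> z - \<Phi> w)" by (simp add: \<psi>_def)
    then have "norm (z - w) \<le> norm (\<psi> z - \<psi> w) + norm (\<Phi> z - \<Phi> w)"
      by (metis norm_triangle_ineq)
    then show ?thesis using lip[OF that] by simp
  qed
  have xC: "x \<in> C" using \<delta> by (simp add: C_def)
  \<comment> \<open>Adding 1 keeps the divisor in \<epsilon> positive even for \<open>h = 0\<close>.
    The choice of \<epsilon> bounds t h by \<delta>/2, leaving the other half of the radius to the
    contraction.\<close>
  define H where "H = norm h + 1"
  have H: "H > 0" "norm h \<le> H" by (auto simp: H_def add_nonneg_pos)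
  define \<epsilon> where "\<epsilon> = \<delta> / (2 * H)"
  have \<epsilon>: "\<epsilon> > 0" using \<delta> H by (simp add: \<epsilon>_def)
  define I where "I = {-\<epsilon><..<\<epsilon>}"
  have "\<exists>z\<in>C. \<Phi> z = \<Phi> x + t *\<^sub>R h" if t: "t \<in> I" for t
  proof -
    have "norm (t *\<^sub>R h) \<le> \<epsilon> * H"
      unfolding norm_scaleR using t H \<epsilon> by (intro mult_mono) (auto simp: I_def)
    then have th: "norm (t *\<^sub>R h) \<le> \<delta> / 2" using H by (simp add: \<epsilon>_def)
    \<comment> \<open>Fixed points of \<open>T\<close> are exactly the solutions sought.\<close>
    define T where "T w = \<Phi> x + t *\<^sub>R h + \<psi> w" for w
    have "\<exists>!z\<in>C. T z = z"
    proof (rule Banach_fix[of _ "1/2"])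
      show "complete C" by (simp add: C_def complete_eq_closed)
      show "C \<noteq> {}" using xC by blast
      show "T ` C \<subseteq> C"
      proof clarify
        fix w assume w: "w \<in> C"
        have "T w - x = t *\<^sub>R h + (\<psi> w - \<psi> x)" by (simp add: T_def \<psi>_def)
        then have "norm (T w - x) \<le> norm (t *\<^sub>R h) + norm (\<psi> w - \<psi> x)"
          by (metis norm_triangle_ineq)
        also have "\<dots> \<le> \<delta> / 2 + 1/2 * norm (w - x)"
          using th lip[OF w xC] by simp
        also have "\<dots> \<le> \<delta>" using w by (simp add: C_def dist_norm norm_minus_commute)
        finally show "T w \<in> C" by (simp add: C_def dist_norm norm_minus_commute)
      qed
      show "dist (T z) (T w) \<le> 1/2 * dist z w" if "z \<in> C" "w \<in> C" for z w
        using lip[OF that] by (simp add: T_def dist_norm)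
    qed auto
    then obtain z where "z \<in> C" "T z = z" by blast
    moreover from this have "\<Phi> z = \<Phi> x + t *\<^sub>R h"
      by (simp add: T_def \<psi>_def algebra_simps)
    ultimately show ?thesis by blast
  qed
  then obtain c where c: "\<And>t. t \<in> I \<Longrightarrow> c t \<in> C" "\<And>t. t \<in> I \<Longrightarrow> \<Phi> (c t) = \<Phi> x + t *\<^sub>R h"
    by metis
  have "\<exists>v. \<Phi>' (c t) v = h" if "t \<in> I" for t
    by (rule near_id_blinfun_surj[OF near[OF c(1)[OF that]]])
  then obtain D where D: "\<And>t. t \<in> I \<Longrightarrow> \<Phi>' (c t) (D t) = h"
    by metis
  have 0: "0 \<in> I" using \<epsilon> by (simp add: I_def)
  have c0: "c 0 = x"
    using inj[OF c(1)[OF 0] xC] c(2)[OF 0] by simp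
  have c_lip: "norm (c s - c t) \<le> 2 * H * \<bar>s - t\<bar>" if "s \<in> I" "t \<in> I" for s t
  proof -
    have "\<Phi> (c s) - \<Phi> (c t) = (s - t) *\<^sub>R h" using c(2) that by (simp add: algebra_simps)
    then have "norm (c s - c t) \<le> 2 * (\<bar>s - t\<bar> * norm h)"
      using inj[OF c(1)[OF that(1)] c(1)[OF that(2)]] by simp
    also have "\<dots> \<le> 2 * (\<bar>s - t\<bar> * H)" using H by (simp add: mult_left_mono)
    finally show ?thesis by (simp add: mult_ac)
  qed
  have c_der: "(c has_vector_derivative D t) (at t)" if t: "t \<in> I" for t
    unfolding has_vector_derivative_def has_derivative_at_alt
  proof (intro conjI allI impI bounded_linear_scaleR_left)
    fix e :: real assume e: "e > 0"
    \<comment> \<open>The 4 H pays for the Lipschitz constant 2 H of \<open>c\<close> and the factor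
      2 lost in inverting the derivative of \<Phi>.\<close>
    define e' where "e' = e / (4 * H)"
    have e': "e' > 0" using e H by (simp add: e'_def)
    obtain d' where d': "d' > 0"
      and lin: "\<And>y. norm (y - c t) < d' \<Longrightarrow>
        norm (\<Phi> y - \<Phi> (c t) - \<Phi>' (c t) (y - c t)) \<le> e' * norm (y - c t)"
      using der[OF CU[OF c(1)[OF t]]] e' unfolding has_derivative_at_alt by blast
    \<comment> \<open>The first bound keeps \<open>s\<close> in \<open>I\<close>, the second keeps
      \<open>c s\<close> within \<open>d'\<close> of \<open>c t\<close>.\<close>
    define d where "d = min (\<epsilon> - \<bar>t\<bar>) (d' / (2 * H))"
    show "\<exists>d>0. \<forall>s. norm (s - t) < d \<longrightarrow>
        norm (c s - c t - (s - t) *\<^sub>R D t) \<le> e * norm (s - t)"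
    proof (intro exI[of _ d] conjI allI impI)
      show "d > 0" using t d' H by (auto simp: d_def I_def)
      fix s assume s: "norm (s - t) < d"
      then have sI: "s \<in> I" by (auto simp: d_def I_def)
      have "2 * H * \<bar>s - t\<bar> < d'"
        using s H by (simp add: d_def field_simps)
      then have close: "norm (c s - c t) < d'"
        using c_lip[OF sI t] by linarith
      \<comment> \<open>Since \<Phi> maps \<open>c\<close> to a line with direction
        \<open>h\<close>, its linearization error is, up to sign, the image of the linearization
        error of \<open>c\<close>.\<close>
      have "\<Phi> (c s) - \<Phi> (c t) - \<Phi>' (c t) (c s - c t)
          = - \<Phi>' (c t) (c s - c t - (s - t) *\<^sub>R D t)"
        by (simp add: c(2) sI t D blinfun.diff_right blinfun.scaleR_right scaleR_diff_left)
      then have "norm (\<Phi>' (c t) (c s - c t - (s - t) *\<^sub>R D t)) \<le> e' * norm (c s - c t)"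
        using lin[OF close] by simp
      then have "norm (c s - c t - (s - t) *\<^sub>R D t) \<le> 2 * (e' * norm (c s - c t))"
        using norm_le_near_id_blinfun[OF near[OF c(1)[OF t]],
            of "c s - c t - (s - t) *\<^sub>R D t"] by simp
      also have "\<dots> \<le> 2 * (e' * (2 * H * \<bar>s - t\<bar>))"
        using c_lip[OF sI t] e' by (simp add: mult_left_mono)
      also have "\<dots> = e * norm (s - t)" using H by (simp add: e'_def)
      finally show "norm (c s - c t - (s - t) *\<^sub>R D t) \<le> e * norm (s - t)" .
    qed
  qed
  have "isCont D t" if t: "t \<in> I" for t
  proof -
    have "isCont c t" using has_vector_derivative_continuous[OF c_der[OF t]] .
    moreover have "isCont \<Phi>' (c t)"
      using cont CU[OF c(1)[OF t]] assms(1) by (simp add: continuous_on_eq_continuous_at)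
    ultimately have "isCont (\<lambda>s. \<Phi>' (c s)) t" by (rule isCont_o2)
    then have "((\<lambda>s. 2 * norm ((\<Phi>' (c t) - \<Phi>' (c s)) (D t)))
        \<longlongrightarrow> 2 * norm ((\<Phi>' (c t) - \<Phi>' (c t)) (D t))) (at t)"
      unfolding isCont_def by (intro tendsto_intros)
    then have lim: "((\<lambda>s. 2 * norm ((\<Phi>' (c t) - \<Phi>' (c s)) (D t))) \<longlongrightarrow> 0) (at t)"
      by simp
    have "\<forall>\<^sub>F s in at t. s \<in> I"
      using t by (intro eventually_at_in_open') (auto simp: I_def)
    then have "\<forall>\<^sub>F s in at t. norm (D s - D t) \<le> 2 * norm ((\<Phi>' (c t) - \<Phi>' (c s)) (D t))"
    proof eventually_elim
      case (elim s)
      \<comment> \<open>Both velocities are sent to \<open>h\<close> by their own derivatives. The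
        right side has the fixed argument \<open>D t\<close>, so continuity of the derivative along
        \<open>c\<close> suffices.\<close>
      have "\<Phi>' (c s) (D s - D t) = (\<Phi>' (c t) - \<Phi>' (c s)) (D t)"
        using D[OF elim] D[OF t] by (simp add: blinfun.diff_left blinfun.diff_right)
      then show ?case
        using norm_le_near_id_blinfun[OF near[OF c(1)[OF elim]], of "D s - D t"] by simp
    qed
    then have "((\<lambda>s. D s - D t) \<longlongrightarrow> 0) (at t)"
      using lim by (rule Lim_null_comparison)
    then show ?thesis by (simp add: isCont_def Lim_null[symmetric])
  qed
  then have "continuous_on I D" by (simp add: continuous_at_imp_continuous_on)
  moreover have "D 0 = h" using D[OF 0] by (simp add: c0 id)
  ultimately show thesis
    using \<epsilon> c0 c_der D CU c(1) unfolding I_def by (intro that[of \<epsilon> c D]) auto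
qed

section \<open>Curves in the level set with prescribed velocity\<close>

lemma tangent_curve_exists:
  fixes g :: "'a::banach \<Rightarrow> 'b::banach" and G :: "'b \<Rightarrow>\<^sub>L 'a"
  assumes C1: "C1_map_on U g g'"
    and reg: "generalized_regular_point U g' x"
    and G: "G \<in> GI (g' x)" and h: "h \<in> null_space (g' x)"
  obtains \<epsilon> :: real and c
  where "\<epsilon> > 0" "c C1_differentiable_on {-\<epsilon><..<\<epsilon>}"
    "c ` {-\<epsilon><..<\<epsilon>} \<subseteq> level_set U g (g x)" "c 0 = x" "(c has_vector_derivative h) (at 0)"
proof -
  obtain N W where N: "closed_complement (range_space (g' x)) N"
    and W: "open W" "x \<in> W" "W \<subseteq> U" and trivial: "\<And>z. z \<in> W \<Longrightarrow> range_space (g' z) \<inter> N = {0}"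
    and closed: "closed (range_space (g' x))"
    using reg unfolding generalized_regular_point_def double_split_def by metis
  define A where "A = g' x"
  have "subspace (range_space A)"
    unfolding range_space_def
    by (intro linear_subspace_image bounded_linear.linear blinfun.bounded_linear_right) auto
  then obtain P :: "'b \<Rightarrow>\<^sub>L 'b" where P: "\<And>m. m \<in> range_space A \<Longrightarrow> P m = m"
    "\<And>y. P y \<in> range_space A" "\<And>y. y - P y \<in> N"
    using bounded_projection_exists closed N unfolding A_def by metis
  define T where "T = G o\<^sub>L P"
  have AGA: "A (G (A v)) = A v" for v
    using G unfolding GI_def A_def by (metis (mono_tags) blinfun_apply_blinfun_compose mem_Collect_eq)
  \<comment> \<open>\<open>P y\<close> has the form \<open>A v\<close>, and \<open>A\<close>
    composed with \<open>G\<close> fixes such vectors.\<close>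
  have AT: "A (T y) = P y" for y
    using P(2)[of y] by (auto simp: T_def range_space_def AGA)
  have gder: "\<And>z. z \<in> U \<Longrightarrow> (g has_derivative g' z) (at z)" and gcont: "continuous_on U g'"
    using C1 by (auto simp: C1_map_on_def)
  define \<Phi> where "\<Phi> z = z + T (g z - A z)" for z
  define \<Phi>' where "\<Phi>' z = id_blinfun + (T o\<^sub>L (g' z - A))" for z
  have "C1_map_on W \<Phi> \<Phi>'"
    unfolding C1_map_on_def
  proof (intro conjI ballI)
    fix z assume "z \<in> W"
    then have "((\<lambda>z. z + T (g z - A z)) has_derivative (\<lambda>v. v + T (g' z v - A v))) (at z)"
      using W by (intro derivative_intros gder bounded_linear.has_derivative
          [OF blinfun.bounded_linear_right] ) auto
    moreover have "blinfun_apply (\<Phi>' z) = (\<lambda>v. v + T (g' z v - A v))"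
      by (auto simp: \<Phi>'_def blinfun.add_left blinfun.diff_left)
    ultimately show "(\<Phi> has_derivative \<Phi>' z) (at z)"
      by (simp add: \<Phi>_def[abs_def])
  next
    show "continuous_on W \<Phi>'"
      unfolding \<Phi>'_def
      by (intro continuous_intros continuous_on_subset[OF gcont] W
          bounded_linear.continuous_on[OF bounded_bilinear.bounded_linear_right
            [OF bounded_bilinear_blinfun_compose]])
  qed
  moreover have "\<Phi>' x = id_blinfun"
    by (rule blinfun_eqI) (simp add: \<Phi>'_def A_def blinfun.add_left)
  \<comment> \<open>Lifting inside \<open>W\<close> rather than \<open>U\<close> makes the trivial
    intersection with \<open>N\<close> available along the whole curve.\<close>
  ultimately obtain \<epsilon> :: real and c D where \<epsilon>: "\<epsilon> > 0" and c0: "c 0 = x" and D0: "D 0 = h"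
    and cW: "\<And>t. t \<in> {-\<epsilon><..<\<epsilon>} \<Longrightarrow> c t \<in> W"
    and cder: "\<And>t. t \<in> {-\<epsilon><..<\<epsilon>} \<Longrightarrow> (c has_vector_derivative D t) (at t)"
    and \<Phi>D: "\<And>t. t \<in> {-\<epsilon><..<\<epsilon>} \<Longrightarrow> \<Phi>' (c t) (D t) = h"
    and Dcont: "continuous_on {-\<epsilon><..<\<epsilon>} D"
    using C1_line_lift[OF W(1,2)] by metis
  have g'D: "g' (c t) (D t) = 0" if t: "t \<in> {-\<epsilon><..<\<epsilon>}" for t
  proof -
    let ?y = "g' (c t) (D t)"
    have "0 = A (\<Phi>' (c t) (D t))"
      using h \<Phi>D[OF t] by (simp add: A_def null_space_def)
    also have "\<dots> = A (D t) + P (?y - A (D t))"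
      by (simp add: \<Phi>'_def blinfun.add_left blinfun.add_right blinfun.diff_left AT)
    \<comment> \<open>\<open>P\<close> fixes \<open>A (D t)\<close>, so the two terms with
      \<open>A (D t)\<close> cancel.\<close>
    also have "\<dots> = P ?y"
      using P(1)[of "A (D t)"] by (simp add: blinfun.diff_right range_space_def)
    finally have "?y \<in> N" using P(3)[of ?y] by simp
    then show ?thesis
      using trivial[OF cW[OF t]] by (auto simp: range_space_def)
  qed
  have const: "g (c t) = g x" if t: "t \<in> {-\<epsilon><..<\<epsilon>}" for t
  proof -
    have "((\<lambda>s. g (c s)) has_derivative (\<lambda>v. 0)) (at s within {-\<epsilon><..<\<epsilon>})"
      if s: "s \<in> {-\<epsilon><..<\<epsilon>}" for s
    proof -
      have "((\<lambda>s. g (c s)) has_derivative (\<lambda>v. g' (c s) (v *\<^sub>R D s))) (at s)"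
        using has_derivative_compose[OF cder[OF s, unfolded has_vector_derivative_def]
            gder[of "c s"]] cW[OF s] W by blast
      then show ?thesis
        by (simp add: blinfun.scaleR_right g'D[OF s] has_derivative_at_withinI)
    qed
    from has_derivative_zero_unique[OF _ this t, of 0] show ?thesis
      using \<epsilon> by (simp add: c0)
  qed
  show thesis
  proof (rule that[of \<epsilon> c])
    show "\<epsilon> > 0" "c 0 = x" by fact+
    show "c C1_differentiable_on {-\<epsilon><..<\<epsilon>}"
      using cder Dcont unfolding C1_differentiable_on_def by blast
    show "c ` {-\<epsilon><..<\<epsilon>} \<subseteq> level_set U g (g x)"
      using cW W const by (auto simp: level_set_def)
    show "(c has_vector_derivative h) (at 0)"
      using cder[of 0] \<epsilon> D0 by simp
  qed
qed

section \<open>The Euler equation at a critical point\<close>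

theorem theorem3p1:
  fixes U :: "'e::banach set"
    and g :: "'e \<Rightarrow> 'f::banach" and g' :: "'e \<Rightarrow> 'e \<Rightarrow>\<^sub>L 'f"
    and f :: "'e \<Rightarrow> real" and f' :: "'e \<Rightarrow> 'e \<Rightarrow>\<^sub>L real"
    and y\<^sub>0 :: 'f and x :: 'e
  assumes "open U"
    and "C1_map_on U g g'"
    and "C1_map_on U f f'"
    and "generalized_regular_value U g g' y\<^sub>0"
    and "x \<in> U"
    and "critical_point_on (level_set U g y\<^sub>0) f x"
  shows "\<forall>G \<in> GI (g' x).
           f' x - (f' x o\<^sub>L G o\<^sub>L g' x) = 0 \<and> g x = y\<^sub>0
           \<and> lagrange_multiplier U g g' f' y\<^sub>0 x (f' x o\<^sub>L G)"
proof
  fix G assume G: "G \<in> GI (g' x)"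
  have xS: "x \<in> level_set U g y\<^sub>0"
    using assms(6) by (simp add: critical_point_on_def)
  then have gx: "g x = y\<^sub>0" by (simp add: level_set_def)
  have reg: "generalized_regular_point U g' x"
    using assms(4) xS by (simp add: generalized_regular_value_def)
  have tangent: "f' x h = 0" if h: "h \<in> null_space (g' x)" for h
  proof -
    obtain \<epsilon> :: real and c where c: "\<epsilon> > 0" "c C1_differentiable_on {-\<epsilon><..<\<epsilon>}"
      "c ` {-\<epsilon><..<\<epsilon>} \<subseteq> level_set U g (g x)" "c 0 = x" "(c has_vector_derivative h) (at 0)"
      using tangent_curve_exists[OF assms(2) reg G h] by metis
    then have "((\<lambda>t. f (c t)) has_real_derivative 0) (at 0)"
      using assms(6) gx unfolding critical_point_on_def by blast
    then have "((\<lambda>t. f (c t)) has_derivative (\<lambda>v. 0)) (at 0)"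
      by (simp add: has_field_derivative_def lambda_zero)
    moreover have "(f has_derivative f' x) (at (c 0))"
      using assms(3,5) c(4) by (simp add: C1_map_on_def)
    then have "((\<lambda>t. f (c t)) has_derivative (\<lambda>v. f' x (v *\<^sub>R h))) (at 0)"
      by (rule has_derivative_compose[OF c(5)[unfolded has_vector_derivative_def]
            , unfolded diff_zero])
    \<comment> \<open>Criticality and the chain rule give two derivatives of the same function of t,
      which must agree; their value at 1 is the claim.\<close>
    ultimately have "(\<lambda>v::real. f' x (v *\<^sub>R h)) = (\<lambda>v. 0)"
      by (rule has_derivative_unique[symmetric])
    from fun_cong[OF this, of 1] show ?thesis by simp
  qed
  have "f' x - (f' x o\<^sub>L G o\<^sub>L g' x) = 0"
  proof (rule blinfun_eqI)
    fix v
    have "g' x (G (g' x v)) = g' x v"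
      using G unfolding GI_def by (metis (mono_tags) blinfun_apply_blinfun_compose mem_Collect_eq)
    \<comment> \<open>The preceding identity says that \<open>v - G (g' x v)\<close> is a tangent
      direction.\<close>
    then have "f' x (v - G (g' x v)) = 0"
      by (intro tangent) (simp add: null_space_def blinfun.diff_right)
    then show "(f' x - (f' x o\<^sub>L G o\<^sub>L g' x)) v = blinfun_apply 0 v"
      by (simp add: blinfun.diff_left blinfun.diff_right)
  qed
  with xS gx show "f' x - (f' x o\<^sub>L G o\<^sub>L g' x) = 0 \<and> g x = y\<^sub>0
      \<and> lagrange_multiplier U g g' f' y\<^sub>0 x (f' x o\<^sub>L G)"
    by (simp add: lagrange_multiplier_def)
qed

end
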